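(* For all 4-tuples $A,B,C\in V^4$, where $V=\{\text{marked},\text{unmarked}\}$, $$A\vee_i (B\wedge_j C)=(A\vee_i B)\wedge_j (A\vee_i C),$$ where $\vee_i$ and $\wedge_j$ are the binary operations on $V^4$ $$A\vee_i B = I\big(I^3(A)\cdot I^3(B)\big),\qquad A\wedge_j B = J^3\big(J(A)\cdot J(B)\big),$$ with $I(a,b,c,d)=(\bar{b},a,d,\bar{c})$, $J(a,b,c,d)=(\bar{c},\bar{d},a,b)$, and $\cdot$ denoting componentwise juxtaposition.
   Context: In Laws of Form (LoF) an expression takes one of two values, marked or unmarked. Crossing $x\mapsto\bar{x}$ interchanges the two values. Juxtaposition $xy$ of $x,y\in V$ is marked if at least one of $x,y$ is marked and unmarked otherwise (i.e. it is Boolean "or" with marked read as true). On 4-tuples, juxtaposition is componentwise: $(a,b,c,d)\cdot(e,f,g,h)=(ae,bf,cg,dh)$. Powers such as $I^3$ denote iterated composition of the operator with itself. *)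

theory Defs
  imports Main
begin

datatype lof_val = Marked | Unmarked

fun crossing :: "lof_val \<Rightarrow> lof_val" where
  "crossing Marked = Unmarked"
| "crossing Unmarked = Marked"

definition juxt :: "lof_val \<Rightarrow> lof_val \<Rightarrow> lof_val" where
  "juxt x y = (if x = Marked \<or> y = Marked then Marked else Unmarked)"

type_synonym lof_tuple = "lof_val \<times> lof_val \<times> lof_val \<times> lof_val"

fun juxt4 :: "lof_tuple \<Rightarrow> lof_tuple \<Rightarrow> lof_tuple" where
  "juxt4 (a, b, c, d) (e, f, g, h) = (juxt a e, juxt b f, juxt c g, juxt d h)"

fun op_I :: "lof_tuple \<Rightarrow> lof_tuple" where
  "op_I (a, b, c, d) = (crossing b, a, d, crossing c)"

fun op_J :: "lof_tuple \<Rightarrow> lof_tuple" where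
  "op_J (a, b, c, d) = (crossing c, crossing d, a, b)"

definition join_i :: "lof_tuple \<Rightarrow> lof_tuple \<Rightarrow> lof_tuple"  (infix "\<or>\<^sub>i" 65) where
  "A \<or>\<^sub>i B = op_I (juxt4 ((op_I ^^ 3) A) ((op_I ^^ 3) B))"

definition meet_j :: "lof_tuple \<Rightarrow> lof_tuple \<Rightarrow> lof_tuple"  (infix "\<and>\<^sub>j" 65) where
  "A \<and>\<^sub>j B = (op_J ^^ 3) (juxt4 (op_J A) (op_J B))"

end

(* In each coordinate, join_i and meet_j act as Boolean "and" or "or" (patterns and-or-or-and
   and or-or-and-and), so the claim reduces to distributivity in the two-element lattice. *)
theory Submission
  imports Defs
begin

text \<open>Both operators square to crossing every coordinate, so their cubes invert them and each
  operation is a conjugate of \<open>juxt4\<close>. The four coordinates pair "and" or "or" with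
  "and" or "or" in every way: two distributive laws and two cases of an operation distributing over
  itself.\<close>

lemma crossing_juxt_eq_Marked_iff:
  "crossing x = Marked \<longleftrightarrow> x \<noteq> Marked"
  "juxt x y = Marked \<longleftrightarrow> x = Marked \<or> y = Marked"
  by (cases x; simp) (simp add: juxt_def)

lemma lof_val_eqI: "(x = Marked \<longleftrightarrow> y = Marked) \<Longrightarrow> x = y"
  by (cases x; cases y) simp_all

lemma crossing_crossing: "crossing (crossing x) = x"
  by (cases x) simp_all

text \<open>By De Morgan, conjugation gives "and" exactly where \<open>op_I\<close> crosses its
  output.\<close>

lemma join_i_tuple:
  "(a, b, c, d) \<or>\<^sub>i (e, f, g, h) =
    (crossing (juxt (crossing a) (crossing e)), juxt b f,
     juxt c g, crossing (juxt (crossing d) (crossing h)))"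
  by (simp add: join_i_def numeral_3_eq_3 crossing_crossing)

lemma meet_j_tuple:
  "(a, b, c, d) \<and>\<^sub>j (e, f, g, h) =
    (juxt a e, juxt b f,
     crossing (juxt (crossing c) (crossing g)), crossing (juxt (crossing d) (crossing h)))"
  by (simp add: meet_j_def numeral_3_eq_3 crossing_crossing)

theorem mainTheorem3:
  fixes A B C :: lof_tuple
  shows "A \<or>\<^sub>i (B \<and>\<^sub>j C) = (A \<or>\<^sub>i B) \<and>\<^sub>j (A \<or>\<^sub>i C)"
proof -
  obtain a b c d where A: "A = (a, b, c, d)" by (cases A)
  obtain e f g h where B: "B = (e, f, g, h)" by (cases B)
  obtain p q r s where C: "C = (p, q, r, s)" by (cases C)
  show ?thesis
    unfolding A B C join_i_tuple meet_j_tuple prod.inject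
    \<comment> \<open>Each coordinate becomes a propositional tautology about being
      \<open>Marked\<close>.\<close>
    by (intro conjI lof_val_eqI; unfold crossing_juxt_eq_Marked_iff; blast)
qed

end
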